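(* Let $n\in\mathbb{N}$ and let $G$ be the graph with vertex set $\{r_0,r_1,\dots,r_n\}\,\dot\cup\,\{w_1,\dots,w_{n-1}\}$ (all listed vertices distinct) whose edges are exactly: $r_ir_{i+1}$ for all $0\le i<n$; $w_iw_{i+1}$ for all $1\le i<n-1$; and $w_ir_{i+1}$ and $w_ir_{i-1}$ for all $1\le i\le n-1$. Then the set $\{r_0,r_1,\dots,r_n\}$ is agile in $G$, but $G$ does not contain $K_{2,5}$ as a minor.
   Context: Graphs are simple and undirected. A pair $(X_1,X_2)$ of disjoint vertex sets of a graph $G$ is independent if there are two disjoint trees $T_1,T_2$ in $G$ such that $X_1\subseteq V(T_1)$ and $X_2\subseteq V(T_2)$ (partition classes may be empty, and if $X_i=\emptyset$ the corresponding $T_i$ may be taken empty). A set $X\subseteq V(G)$ is agile (in $G$) if for every partition $X=X_1\,\dot\cup\,X_2$ the pair $(X_1,X_2)$ is independent. *)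

theory Defs
  imports "Graph_Theory.Graph_Theory"
begin

text \<open>
  A simple undirected graph is a loop-free symmetric digraph without parallel arcs
  (\<^locale>\<open>pair_bidirected_digraph\<close>): each edge is a pair of opposite arcs.
\<close>

text \<open>
  The library's \<^const>\<open>tree\<close> forbids every closed directed walk without repeated
  vertices, including the walk \<open>u, v, u\<close> along a single undirected edge. For symmetric
  digraphs only cycles of length at least 3 are cycles of the undirected graph.
  \<^const>\<open>Digraph_Component.connected\<close> requires a nonempty vertex set, so a tree has a vertex.
\<close>
definition ugraph_tree :: "'a pair_pre_digraph \<Rightarrow> bool" where
  "ugraph_tree T \<longleftrightarrow>
     pair_bidirected_digraph T \<and>
     Digraph_Component.connected (with_proj T) \<and>
     \<not> (\<exists>p. pre_digraph.cycle (with_proj T) p \<and> 3 \<le> length p)"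

definition empty_ugraph :: "'a pair_pre_digraph" where
  "empty_ugraph = \<lparr>pverts = {}, parcs = {}\<rparr>"

definition independent_pair :: "'a pair_pre_digraph \<Rightarrow> 'a set \<Rightarrow> 'a set \<Rightarrow> bool" where
  "independent_pair G X1 X2 \<longleftrightarrow>
     (\<exists>T1 T2. subgraph (with_proj T1) (with_proj G) \<and> subgraph (with_proj T2) (with_proj G) \<and>
        (ugraph_tree T1 \<or> X1 = {} \<and> T1 = empty_ugraph) \<and>
        (ugraph_tree T2 \<or> X2 = {} \<and> T2 = empty_ugraph) \<and>
        pverts T1 \<inter> pverts T2 = {} \<and>
        X1 \<subseteq> pverts T1 \<and> X2 \<subseteq> pverts T2)"

definition agile :: "'a pair_pre_digraph \<Rightarrow> 'a set \<Rightarrow> bool" where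
  "agile G X \<longleftrightarrow>
     X \<subseteq> pverts G \<and>
     (\<forall>X1 X2. X1 \<union> X2 = X \<and> X1 \<inter> X2 = {} \<longrightarrow> independent_pair G X1 X2)"

text \<open>
  \<open>B x\<close> is the branch set of the vertex \<open>x\<close> of \<open>H\<close>: contracting the branch sets
  in a suitable subgraph of \<open>G\<close> yields a copy of \<open>H\<close>.
\<close>
definition is_minor :: "'b pair_pre_digraph \<Rightarrow> 'a pair_pre_digraph \<Rightarrow> bool" where
  "is_minor H G \<longleftrightarrow>
     (\<exists>B :: 'b \<Rightarrow> 'a set.
        (\<forall>x\<in>pverts H. B x \<noteq> {} \<and> B x \<subseteq> pverts G \<and>
           Digraph_Component.connected (with_proj G \<restriction> B x)) \<and>
        (\<forall>x\<in>pverts H. \<forall>y\<in>pverts H. x \<noteq> y \<longrightarrow> B x \<inter> B y = {}) \<and>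
        (\<forall>(x, y)\<in>parcs H. \<exists>u\<in>B x. \<exists>v\<in>B y. (u, v) \<in> parcs G))"

end

theory Submission
  imports Defs
begin

text \<open>
  Call \<open>i\<close> the level of \<open>r\<^sub>i\<close> and \<open>w\<^sub>i\<close>. Consecutive levels are completely joined and there
  are no other edges. Given a partition of the \<open>r\<^sub>i\<close>, hand each \<open>w\<^sub>i\<close> to the class not
  containing \<open>r\<^sub>i\<close>: each class then owns one vertex on every inner level, hence induces a path.

  A connected set occupies an interval of levels. Let \<open>A\<close>, \<open>B\<close> be the two branch sets on the side
  of size 2, \<open>l\<close> the larger of their lowest and \<open>h\<close> the smaller of their highest levels. Any
  branch set \<open>C\<close> adjacent to both reaches down to level \<open>h + 1\<close> and up to level \<open>l - 1\<close>. If
  \<open>l \<le> h\<close>, then \<open>A\<close> and \<open>B\<close> exhaust the levels from \<open>l\<close> to \<open>h\<close>, so \<open>C\<close> meets level \<open>l - 1\<close> or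
  \<open>h + 1\<close>; if \<open>h < l\<close>, then \<open>C\<close> meets level \<open>l\<close> or \<open>h\<close>, or level \<open>h + 1\<close>. Levels have at most
  two vertices, so in each case at most four disjoint sets \<open>C\<close> fit.
\<close>

section \<open>Paths are trees in the sense of \<open>ugraph_tree\<close>\<close>

text \<open>A step that reverses its predecessor would repeat a value, so all steps equal the first
  one, \<open>d\<close>, and \<open>k\<close> is linear; closing up then forces
  \<open>m * d = 0\<close>. The bound is sharp: the sequence 0, 1, 0 has
  \<open>m = 2\<close>.\<close>

lemma unit_step_closed_sequence:
  fixes k :: "nat \<Rightarrow> int"
  assumes step: "\<And>i. i < m \<Longrightarrow> \<bar>k (Suc i) - k i\<bar> = 1"
    and inj: "inj_on k {1..m}" and closed: "k 0 = k m"
  shows "m < 3"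
proof (rule ccontr)
  assume "\<not> m < 3"
  then have m: "3 \<le> m" by simp
  define d where "d = k 1 - k 0"
  have d: "\<bar>d\<bar> = 1" using step[of 0] m by (simp add: d_def)
  have no_return: "k (Suc (Suc i)) \<noteq> k i" if "Suc (Suc i) \<le> m" for i
  proof (cases i)
    case 0
    \<comment> \<open>Index 0 lies outside the range of injectivity, so \<open>k 0\<close> is
      replaced by \<open>k m\<close>; this needs \<open>m\<close> to differ from 2.\<close>
    have "k 2 \<noteq> k m" using inj m by (auto dest: inj_onD)
    then show ?thesis using 0 closed by (simp add: numeral_2_eq_2)
  next
    case Suc
    then show ?thesis using inj that by (auto dest: inj_onD)
  qed
  have steps: "k (Suc i) - k i = d" if "i < m" for i
    using that
  proof (induction i)
    case 0
    show ?case by (simp add: d_def)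
  next
    case (Suc i)
    then show ?case using step[of "Suc i"] no_return[of i] d by auto
  qed
  have "k i = k 0 + int i * d" if "i \<le> m" for i
    using that
  proof (induction i)
    case (Suc i)
    then show ?case using steps[of i] by (simp add: algebra_simps)
  qed simp
  from this[OF order_refl] have "int m * d = 0" using closed by linarith
  then show False using d m by auto
qed

lemma pawalk_verts_nth_arc:
  assumes "pcas u p v" "set p \<subseteq> R" "i < length p"
  shows "(pawalk_verts u p ! i, pawalk_verts u p ! Suc i) \<in> R"
  using assms
proof (induction p arbitrary: u i)
  case (Cons e p)
  then show ?case by (cases i; cases p) auto
qed simp

lemma length_pawalk_verts: "length (pawalk_verts u p) = Suc (length p)"
  by (induction p arbitrary: u) auto

lemma pawalk_verts_ends:
  assumes "pcas u p v"
  shows "pawalk_verts u p ! 0 = u" "pawalk_verts u p ! length p = v"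
  using assms by (induction p arbitrary: u) auto

text \<open>Reading \<open>h\<close> along the cycle gives a closed integer sequence. A cycle has a
  distinct vertex list apart from its first entry, which is injectivity from index 1 on.\<close>

lemma cycle_length_less_3_if_unit_steps:
  fixes h :: "'a \<Rightarrow> int"
  assumes wf: "pair_wf_digraph T"
    and inj: "inj_on h (pverts T)"
    and step: "\<And>u v. (u, v) \<in> parcs T \<Longrightarrow> \<bar>h v - h u\<bar> = 1"
    and cyc: "pre_digraph.cycle (with_proj T) p"
  shows "length p < 3"
proof -
  interpret pair_wf_digraph T by fact
  obtain u where u: "awalk u p u" "distinct (tl (pawalk_verts u p))"
    using cyc unfolding cycle_def by auto
  define vs where "vs = pawalk_verts u p"
  have cas: "pcas u p u" and p: "set p \<subseteq> parcs T" and vs: "set vs \<subseteq> pverts T"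
    using u(1) by (auto simp: vs_def elim!: awalkE)
  have len: "length vs = Suc (length p)" by (simp add: vs_def length_pawalk_verts)
  show ?thesis
  proof (rule unit_step_closed_sequence[where k = "\<lambda>i. h (vs ! i)"])
    show "\<bar>h (vs ! Suc i) - h (vs ! i)\<bar> = 1" if "i < length p" for i
      using pawalk_verts_nth_arc[OF cas p that] step by (simp add: vs_def)
    show "inj_on (\<lambda>i. h (vs ! i)) {1..length p}"
    proof (rule inj_onI)
      fix i j
      assume ij: "i \<in> {1..length p}" "j \<in> {1..length p}" and eq: "h (vs ! i) = h (vs ! j)"
      have "vs ! i \<in> pverts T" "vs ! j \<in> pverts T"
        using ij vs len by (auto intro!: subsetD[OF vs] nth_mem)
      with eq inj have "vs ! i = vs ! j" by (auto dest: inj_onD)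
      then have "tl vs ! (i - 1) = tl vs ! (j - 1)"
        using ij len by (cases i; cases j) (auto simp: nth_tl)
      then have "i - 1 = j - 1"
        using u(2) ij len by (subst (asm) nth_eq_iff_index_eq) (auto simp: vs_def)
      then show "i = j" using ij by auto
    qed
    show "h (vs ! 0) = h (vs ! length p)"
      using pawalk_verts_ends[OF cas] by (simp add: vs_def)
  qed
qed

definition path_ugraph :: "(nat \<Rightarrow> 'a) \<Rightarrow> nat \<Rightarrow> nat \<Rightarrow> 'a pair_pre_digraph" where
  "path_ugraph f a b =
     \<lparr>pverts = f ` {a..b},
      parcs = (\<Union>i\<in>{a..<b}. {(f i, f (Suc i)), (f (Suc i), f i)})\<rparr>"

lemma path_ugraph_simps [simp]:
  "pverts (path_ugraph f a b) = f ` {a..b}"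
  "parcs (path_ugraph f a b) = (\<Union>i\<in>{a..<b}. {(f i, f (Suc i)), (f (Suc i), f i)})"
  by (auto simp: path_ugraph_def)

lemma pair_wf_path_ugraph: "pair_wf_digraph (path_ugraph f a b)"
  by unfold_locales auto

lemma connected_path_ugraph:
  assumes "a \<le> b"
  shows "Digraph_Component.connected (with_proj (path_ugraph f a b))"
proof -
  let ?T = "path_ugraph f a b"
  interpret pair_wf_digraph ?T by (rule pair_wf_path_ugraph)
  interpret S: pair_wf_digraph "mk_symmetric ?T" ..
  have sym: "symmetric (mk_symmetric ?T)" by (rule symmetric_mk_symmetric)
  have "f a \<rightarrow>\<^sup>*\<^bsub>mk_symmetric ?T\<^esub> f i" if "a \<le> i" "i \<le> b" for i
    using that
  proof (induction i rule: dec_induct)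
    case base
    have "f a \<in> pverts (mk_symmetric ?T)" using assms by (simp add: mk_symmetric_def)
    then show ?case by (rule S.reachable_refl)
  next
    case (step i)
    then have "(f i, f (Suc i)) \<in> parcs (mk_symmetric ?T)"
      by (auto simp: mk_symmetric_def intro!: bexI[of _ i])
    with step show ?case by (auto intro: S.reachable_adj_trans)
  qed
  then have from_a: "f a \<rightarrow>\<^sup>*\<^bsub>mk_symmetric ?T\<^esub> x" if "x \<in> pverts ?T" for x
    using that by auto
  show ?thesis
  proof (rule connectedI)
    show "pverts ?T \<noteq> {}" using assms by simp
    fix x y assume "x \<in> pverts ?T" "y \<in> pverts ?T"
    then show "x \<rightarrow>\<^sup>*\<^bsub>mk_symmetric ?T\<^esub> y"
      by (meson from_a S.reachable_trans symmetric_reachable[OF sym])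
  qed
qed

lemma ugraph_tree_path_ugraph:
  assumes inj: "inj_on f {a..b}" and "a \<le> b"
  shows "ugraph_tree (path_ugraph f a b)"
  unfolding ugraph_tree_def
proof (intro conjI notI)
  let ?T = "path_ugraph f a b"
  \<comment> \<open>The position along the path is injective and changes by one along every arc,
    which excludes cycles of length at least 3.\<close>
  let ?h = "\<lambda>v. int (the_inv_into {a..b} f v)"
  note h = the_inv_into_f_f[OF inj]
  interpret pair_wf_digraph ?T by (rule pair_wf_path_ugraph)
  show "pair_bidirected_digraph ?T"
  proof unfold_locales
    show "symmetric (with_proj ?T)" by (auto simp: symmetric_def intro!: symI)
    show "fst e \<noteq> snd e" if "e \<in> parcs ?T" for e
      using that by (auto simp: inj_on_eq_iff[OF inj])
  qed
  show "Digraph_Component.connected (with_proj ?T)" by (rule connected_path_ugraph) fact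
  assume "\<exists>p. pre_digraph.cycle (with_proj ?T) p \<and> 3 \<le> length p"
  then obtain p where p: "pre_digraph.cycle (with_proj ?T) p" "3 \<le> length p" by blast
  have "length p < 3"
  proof (rule cycle_length_less_3_if_unit_steps[where h = ?h, OF pair_wf_path_ugraph _ _ p(1)])
    show "inj_on ?h (pverts ?T)" by (auto simp: inj_on_def h)
    show "\<bar>?h v - ?h u\<bar> = 1" if "(u, v) \<in> parcs ?T" for u v
      using that by (auto simp: h)
  qed
  with p show False by simp
qed

section \<open>Thin levels exclude \<open>K_{2,5}\<close> minors\<close>

text \<open>A discrete intermediate value argument: a walk inside \<open>S\<close> that starts below
  level \<open>k\<close> cannot jump over it, so if \<open>S\<close> misses level \<open>k\<close>
  the walk stays below.\<close>

lemma connected_levels_interval: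
  fixes lev :: "'a \<Rightarrow> int"
  assumes conn: "Digraph_Component.connected (with_proj G \<restriction> S)"
    and step: "\<And>u v. (u, v) \<in> parcs G \<Longrightarrow> \<bar>lev u - lev v\<bar> \<le> 1"
    and S: "u \<in> S" "v \<in> S" and k: "lev u \<le> k" "k \<le> lev v"
  shows "\<exists>x\<in>S. lev x = k"
proof (rule ccontr)
  assume no: "\<not> (\<exists>x\<in>S. lev x = k)"
  interpret pair_wf_digraph "mk_symmetric (with_proj G \<restriction> S)"
    by unfold_locales (auto simp: mk_symmetric_def)
  have "u \<rightarrow>\<^sup>*\<^bsub>mk_symmetric (with_proj G \<restriction> S)\<^esub> v"
    using conn S unfolding Digraph_Component.connected_def strongly_connected_def
    by (auto simp: mk_symmetric_def)
  then have "v \<in> S \<and> lev v < k"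
  proof (induction rule: reachable_induct)
    case base
    show ?case using S k no by force
  next
    case (step x y)
    then have "(x, y) \<in> parcs G \<or> (y, x) \<in> parcs G" and "y \<in> S"
      by (auto simp: mk_symmetric_def)
    then show ?case using step assms(2)[of x y] assms(2)[of y x] no by fastforce
  qed
  with k show False by simp
qed

lemma five_disjoint_sets_not_met_by_four:
  assumes "card V = 5" and P: "finite P" "card P \<le> 4"
    and disj: "\<And>x y. x \<in> V \<Longrightarrow> y \<in> V \<Longrightarrow> x \<noteq> y \<Longrightarrow> C x \<inter> C y = {}"
  shows "\<exists>x\<in>V. C x \<inter> P = {}"
proof (rule ccontr)
  assume "\<not> ?thesis"
  then have "\<forall>x\<in>V. \<exists>y. y \<in> C x \<inter> P" by blast
  then obtain g where g: "\<And>x. x \<in> V \<Longrightarrow> g x \<in> C x \<inter> P"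
    using bchoice[of V "\<lambda>x y. y \<in> C x \<inter> P"] by blast
  then have "inj_on g V" using disj by (fastforce intro!: inj_onI)
  then have "card V \<le> card P" using g P(1) by (intro card_inj_on_le) auto
  then show False using assms by simp
qed

text \<open>These properties of the graph carry the whole exclusion argument. Levels are integers so
  that \<open>l - 1\<close> is not truncated at 0.\<close>

locale thin_levels =
  fixes G :: "'a pair_pre_digraph" and lev :: "'a \<Rightarrow> int"
  assumes finite_verts: "finite (pverts G)"
    and lev_step: "(u, v) \<in> parcs G \<Longrightarrow> \<bar>lev u - lev v\<bar> \<le> 1"
    and card_level: "card {v \<in> pverts G. lev v = k} \<le> 2"
begin

definition level :: "int \<Rightarrow> 'a set" where
  "level k = {v \<in> pverts G. lev v = k}"

definition connected_on :: "'a set \<Rightarrow> bool" where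
  "connected_on S \<longleftrightarrow> S \<noteq> {} \<and> S \<subseteq> pverts G \<and> Digraph_Component.connected (with_proj G \<restriction> S)"

definition touches :: "'a set \<Rightarrow> 'a set \<Rightarrow> bool" where
  "touches S T \<longleftrightarrow> (\<exists>u\<in>S. \<exists>v\<in>T. (u, v) \<in> parcs G)"

lemma finite_level: "finite (level k)"
  using finite_verts by (simp add: level_def)

lemma card_two_levels: "card (level j \<union> level k) \<le> 4"
  using card_Un_le[of "level j" "level k"] card_level[of j] card_level[of k]
  by (simp add: level_def)

lemma meets_level_between:
  assumes "connected_on S" "u \<in> S" "v \<in> S" "lev u \<le> k" "k \<le> lev v"
  shows "S \<inter> level k \<noteq> {}"
  using connected_levels_interval[of G S lev u v k] assms lev_step
  unfolding connected_on_def level_def by blast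

lemma no_three_on_level:
  assumes "A \<inter> level k \<noteq> {}" "B \<inter> level k \<noteq> {}" "C \<inter> level k \<noteq> {}"
    and "A \<inter> B = {}" "A \<inter> C = {}" "B \<inter> C = {}"
  shows False
proof -
  obtain x y z where "x \<in> A \<inter> level k" "y \<in> B \<inter> level k" "z \<in> C \<inter> level k"
    using assms(1-3) by blast
  moreover from this have "x \<noteq> y" "x \<noteq> z" "y \<noteq> z" using assms(4-6) by auto
  ultimately have "{x, y, z} \<subseteq> level k" "card {x, y, z} = 3" by auto
  then have "3 \<le> card (level k)" using card_mono[OF finite_level] by metis
  then show False using card_level[of k] by (simp add: level_def)
qed

lemma level_bounds:
  assumes "connected_on S"
  obtains x y where "x \<in> S" "y \<in> S" "\<And>v. v \<in> S \<Longrightarrow> lev x \<le> lev v \<and> lev v \<le> lev y"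
proof -
  have S: "finite S" "S \<noteq> {}"
    using assms finite_verts finite_subset by (auto simp: connected_on_def)
  obtain x where "x \<in> S" "lev x = Min (lev ` S)"
    using S Min_in[of "lev ` S"] by fastforce
  moreover obtain y where "y \<in> S" "lev y = Max (lev ` S)"
    using S Max_in[of "lev ` S"] by fastforce
  ultimately show thesis using S that by (metis Max_ge Min_le finite_imageI imageI)
qed

text \<open>The set \<open>P\<close> is chosen from \<open>A\<close> and \<open>B\<close> alone,
  before \<open>C\<close>, so that all common neighbours compete for the same four vertices.\<close>

lemma four_vertices_meet_common_neighbours:
  assumes A: "connected_on A" and B: "connected_on B" and AB: "A \<inter> B = {}"
  shows "\<exists>P. finite P \<and> card P \<le> 4 \<and>
    (\<forall>C. connected_on C \<and> C \<inter> A = {} \<and> C \<inter> B = {} \<and> touches C A \<and> touches C B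
      \<longrightarrow> C \<inter> P \<noteq> {})"
proof -
  obtain a1 a2 where a: "a1 \<in> A" "a2 \<in> A" "\<And>v. v \<in> A \<Longrightarrow> lev a1 \<le> lev v \<and> lev v \<le> lev a2"
    using level_bounds[OF A] by metis
  obtain b1 b2 where b: "b1 \<in> B" "b2 \<in> B" "\<And>v. v \<in> B \<Longrightarrow> lev b1 \<le> lev v \<and> lev v \<le> lev b2"
    using level_bounds[OF B] by metis
  define l where "l = max (lev a1) (lev b1)"
  define h where "h = min (lev a2) (lev b2)"
  \<comment> \<open>If \<open>l <= h\<close>, the level ranges of \<open>A\<close> and
    \<open>B\<close> overlap in \<open>{l..h}\<close>. Otherwise \<open>h\<close> is the top of the
    lower set and \<open>l\<close> the bottom of the upper one, with or without a level strictly
    between. The union of \<open>level (h + 1)\<close> with itself only fits the form of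
    \<open>card_two_levels\<close>.\<close>
  define P where "P = (if l \<le> h then level (l - 1) \<union> level (h + 1)
    else if l = h + 1 then level l \<union> level h else level (h + 1) \<union> level (h + 1))"
  have "C \<inter> P \<noteq> {}"
    if C: "connected_on C" "C \<inter> A = {}" "C \<inter> B = {}" "touches C A" "touches C B" for C
  proof -
    obtain u v where u: "u \<in> C" "v \<in> A" "\<bar>lev u - lev v\<bar> \<le> 1"
      using C lev_step unfolding touches_def by blast
    obtain u' v' where u': "u' \<in> C" "v' \<in> B" "\<bar>lev u' - lev v'\<bar> \<le> 1"
      using C lev_step unfolding touches_def by blast
    note bounds = a(3)[OF u(2)] b(3)[OF u'(2)] u(3) u'(3)
    \<comment> \<open>One of \<open>A\<close>, \<open>B\<close> has top level \<open>h\<close>, and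
      a vertex of \<open>C\<close> adjacent to that set serves as \<open>x\<close>. Dually,
      \<open>y\<close> is adjacent to the set with bottom level \<open>l\<close>.\<close>
    obtain x where x: "x \<in> C" "lev x \<le> h + 1"
      using bounds u(1) u'(1) unfolding h_def min_def by (cases "lev a2 \<le> lev b2") force+
    obtain y where y: "y \<in> C" "l - 1 \<le> lev y"
      using bounds u(1) u'(1) unfolding l_def max_def by (cases "lev a1 \<le> lev b1") force+
    have CG: "C \<subseteq> pverts G" using C(1) by (simp add: connected_on_def)
    have avoids: "C \<inter> level k = {}" if "l \<le> k" "k \<le> h" for k
    proof (rule ccontr)
      assume "C \<inter> level k \<noteq> {}"
      moreover have "A \<inter> level k \<noteq> {}" "B \<inter> level k \<noteq> {}"
        using that meets_level_between[OF A a(1,2)] meets_level_between[OF B b(1,2)]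
        by (auto simp: l_def h_def)
      ultimately show False using no_three_on_level[of A k B C] AB C by blast
    qed
    consider "l \<le> h" | "l = h + 1" | "h + 1 < l" by linarith
    then show ?thesis
    proof cases
      case 1
      show ?thesis
      proof (cases "lev x < l")
        case True
        \<comment> \<open>If \<open>y\<close> lay above \<open>h\<close>, then \<open>C\<close>
          would pass from below \<open>l\<close> to above \<open>h\<close> and meet the forbidden
          level \<open>l\<close>.\<close>
        have "lev y < l \<or> h < lev y"
          using avoids[of "lev y"] y CG by (force simp: level_def)
        then have "lev y = l - 1"
          using meets_level_between[OF C(1) x(1) y(1), of l] avoids[of l] 1 True y by fastforce
        then show ?thesis using y CG 1 by (auto simp: P_def level_def)
      next
        case False
        then have "lev x = h + 1"
          using avoids[of "lev x"] x CG by (force simp: level_def)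
        then show ?thesis using x CG 1 by (auto simp: P_def level_def)
      qed
    next
      case 2
      \<comment> \<open>Here \<open>lev x <= l\<close> and \<open>h <= lev y\<close>. Unless one of
        these is an equality, level \<open>h\<close> lies between \<open>x\<close> and
        \<open>y\<close>.\<close>
      then have "C \<inter> level l \<noteq> {} \<or> C \<inter> level h \<noteq> {}"
        using meets_level_between[OF C(1) x(1) y(1), of h] x y CG
        by (cases "lev x = l"; cases "lev y = h") (force simp: level_def)+
      then show ?thesis using 2 by (auto simp: P_def)
    next
      case 3
      then show ?thesis
        using meets_level_between[OF C(1) x(1) y(1), of "h + 1"] x y by (simp add: P_def)
    qed
  qed
  moreover have "finite P" "card P \<le> 4"
    by (simp_all only: P_def finite_level finite_Un card_two_levels split: if_split) auto
  ultimately show ?thesis by blast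
qed

text \<open>The branch sets of the five-element side touch both of the other two, so all would meet
  the same four vertices, against the pigeonhole principle.\<close>

lemma no_K_2_5_minor:
  assumes K: "K\<^bsub>2,5\<^esub> (with_proj K)"
  shows "\<not> is_minor K G"
proof
  assume "is_minor K G"
  then obtain B where minor: "\<forall>x\<in>pverts K. connected_on (B x)"
      "\<forall>x\<in>pverts K. \<forall>y\<in>pverts K. x \<noteq> y \<longrightarrow> B x \<inter> B y = {}"
      "\<forall>(x, y)\<in>parcs K. touches (B x) (B y)"
    unfolding is_minor_def connected_on_def touches_def by blast
  have B: "connected_on (B x)" if "x \<in> pverts K" for x
    using minor(1) that by blast
  have disj: "B x \<inter> B y = {}" if "x \<in> pverts K" "y \<in> pverts K" "x \<noteq> y" for x y
    using minor(2) that by blast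
  have touch: "touches (B x) (B y)" if "(x, y) \<in> parcs K" for x y
    using minor(3) that by blast
  obtain U V where UV: "pverts K = U \<union> V" "U \<inter> V = {}" "card U = 2" "card V = 5"
      "parcs K = U \<times> V \<union> V \<times> U"
    using K unfolding complete_bipartite_digraph_pair_def by auto
  obtain p q where pq: "U = {p, q}" "p \<noteq> q" using UV(3) by (auto simp: card_2_iff)
  obtain P where P: "finite P" "card P \<le> 4"
    and meet: "\<And>C. connected_on C \<Longrightarrow> C \<inter> B p = {} \<Longrightarrow> C \<inter> B q = {} \<Longrightarrow>
      touches C (B p) \<Longrightarrow> touches C (B q) \<Longrightarrow> C \<inter> P \<noteq> {}"
    using four_vertices_meet_common_neighbours[OF B[of p] B[of q] disj[of p q]] UV(1) pq
    by auto
  have "B x \<inter> P \<noteq> {}" if "x \<in> V" for x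
    using that UV pq by (intro meet B disj touch) auto
  moreover have "\<exists>x\<in>V. B x \<inter> P = {}"
    using disj UV by (intro five_disjoint_sets_not_met_by_four[OF UV(4) P]) auto
  ultimately show False by blast
qed

end

section \<open>Agility through complementary paths\<close>

text \<open>The upper bound on \<open>pverts T\<close> makes the trees of complementary classes
  disjoint: \<open>w i\<close> is spent only where \<open>r i\<close> is outside the class. The path
  takes one vertex per level, and \<open>arcs\<close> joins consecutive levels completely.\<close>

lemma path_cover_of_class:
  fixes r w :: "nat \<Rightarrow> 'a"
  assumes inj: "inj_on r {0..n}" "inj_on w {1..<n}" "r ` {0..n} \<inter> w ` {1..<n} = {}"
    and wf: "pair_wf_digraph G"
    and verts: "r ` {0..n} \<union> w ` {1..<n} \<subseteq> pverts G"
    and arcs: "\<And>i x y. i < n \<Longrightarrow> x = r i \<or> x = w i \<and> 1 \<le> i \<Longrightarrow>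
      y = r (Suc i) \<or> y = w (Suc i) \<and> Suc i < n \<Longrightarrow> (x, y) \<in> parcs G \<and> (y, x) \<in> parcs G"
    and X: "X \<subseteq> r ` {0..n}"
  shows "\<exists>T. subgraph (with_proj T) (with_proj G) \<and>
    (ugraph_tree T \<or> X = {} \<and> T = empty_ugraph) \<and>
    X \<subseteq> pverts T \<and> pverts T \<subseteq> X \<union> {w i | i. 1 \<le> i \<and> i < n \<and> r i \<notin> X}"
proof -
  define f where "f i = (if r i \<in> X then r i else w i)" for i
  \<comment> \<open>Levels 0 and \<open>n\<close> have no \<open>w\<close>, so the path skips such
    an end level when its \<open>r\<close> is outside \<open>X\<close>.\<close>
  define a where "a = (if r 0 \<in> X then 0 else 1 :: nat)"
  define b where "b = (if r n \<in> X then n else n - 1)"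
  have ab: "i \<in> {a..b} \<longleftrightarrow> i \<le> n \<and> (r i \<in> X \<or> 1 \<le> i \<and> i < n)" for i
  proof -
    consider "i = 0" | "1 \<le> i" "i < n" | "1 \<le> i" "i = n" | "n < i" by linarith
    then show ?thesis by cases (auto simp: a_def b_def)
  qed
  have inj_f: "inj_on f {a..b}"
  proof (rule inj_onI)
    fix i j assume "i \<in> {a..b}" "j \<in> {a..b}" "f i = f j"
    moreover have "r i' \<noteq> w j'" if "i' \<le> n" "1 \<le> j'" "j' < n" for i' j'
      using inj(3) that by (force simp: disjoint_iff)
    ultimately show "i = j"
      using inj(1,2) unfolding ab f_def
      by (force split: if_splits dest: inj_onD)
  qed
  have cover: "X \<subseteq> f ` {a..b}"
  proof
    fix x assume "x \<in> X"
    with X obtain i where "x = r i" "i \<le> n" by auto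
    with \<open>x \<in> X\<close> show "x \<in> f ` {a..b}" using ab[of i] by (auto simp: f_def)
  qed
  have inside: "f ` {a..b} \<subseteq> X \<union> {w i | i. 1 \<le> i \<and> i < n \<and> r i \<notin> X}"
    using ab by (auto simp: f_def)
  show ?thesis
  proof (cases "a \<le> b")
    case True
    let ?T = "path_ugraph f a b"
    have "{w i | i. 1 \<le> i \<and> i < n \<and> r i \<notin> X} \<subseteq> w ` {1..<n}" by auto
    then have "f ` {a..b} \<subseteq> r ` {0..n} \<union> w ` {1..<n}"
      using inside X by (meson Un_mono order_trans)
    then have "pverts ?T \<subseteq> pverts G"
      unfolding path_ugraph_simps using verts by (rule subset_trans)
    moreover have "parcs ?T \<subseteq> parcs G"
    proof -
      have "(f i, f (Suc i)) \<in> parcs G \<and> (f (Suc i), f i) \<in> parcs G" if "i \<in> {a..<b}" for i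
        using that ab[of i] ab[of "Suc i"] by (intro arcs[of i]) (auto simp: f_def)
      then show ?thesis by auto
    qed
    ultimately have "subgraph (with_proj ?T) (with_proj G)"
      using wf pair_wf_path_ugraph[of f a b]
      by (simp add: subgraph_def compatible_def wf_digraph_wp_iff)
    then show ?thesis
      using ugraph_tree_path_ugraph[OF inj_f True] cover inside
      by (intro exI[of _ ?T]) simp
  next
    \<comment> \<open>The range is empty only for \<open>n <= 1\<close> and empty \<open>X\<close>:
      there is then no inner level to supply a vertex.\<close>
    case False
    then have "X = {}" using cover by simp
    moreover have "subgraph (with_proj empty_ugraph) (with_proj G)"
      using wf by (auto simp: subgraph_def compatible_def wf_digraph_wp_iff empty_ugraph_def
          pair_wf_digraph_def)
    ultimately show ?thesis by (intro exI[of _ empty_ugraph]) (simp add: empty_ugraph_def)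
  qed
qed

theorem mainTheorem4:
  fixes n :: nat
    and G :: "'a pair_pre_digraph"
    and r w :: "nat \<Rightarrow> 'a"
    and E :: "'a rel"
  assumes "inj_on r {0..n}"
    and "inj_on w {1..<n}"
    and "r ` {0..n} \<inter> w ` {1..<n} = {}"
    and "pverts G = r ` {0..n} \<union> w ` {1..<n}"
    and "E = {(r i, r (i + 1)) | i. i < n}
           \<union> {(w i, w (i + 1)) | i. 1 \<le> i \<and> i < n - 1}
           \<union> {(w i, r (i + 1)) | i. 1 \<le> i \<and> i \<le> n - 1}
           \<union> {(w i, r (i - 1)) | i. 1 \<le> i \<and> i \<le> n - 1}"
    and "parcs G = E \<union> E\<inverse>"
  shows "agile G (r ` {0..n}) \<and>
    \<not> (\<exists>K :: nat pair_pre_digraph. K\<^bsub>2,5\<^esub> (with_proj K) \<and> is_minor K G)"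
proof
  let ?R = "r ` {0..n}"
  have w_notin_R: "w i \<notin> ?R" if "1 \<le> i" "i < n" for i
    using assms(3) that by (meson atLeastLessThan_iff disjoint_iff image_eqI)
  have E_verts: "fst e \<in> pverts G \<and> snd e \<in> pverts G" if "e \<in> E" for e
    using that unfolding assms(4,5) by auto
  have wf: "pair_wf_digraph G"
    by unfold_locales (use E_verts assms(6) in fastforce)+
  have arcs: "(x, y) \<in> parcs G \<and> (y, x) \<in> parcs G"
    if "i < n" "x = r i \<or> x = w i \<and> 1 \<le> i" "y = r (Suc i) \<or> y = w (Suc i) \<and> Suc i < n"
    for i x y
  proof -
    have "(r i, r (Suc i)) \<in> E" using that(1) by (auto simp: assms(5))
    moreover have "(w i, r (Suc i)) \<in> E" if "1 \<le> i"
      using that \<open>i < n\<close> by (auto simp: assms(5))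
    \<comment> \<open>This is the family of edges from \<open>w i\<close> to
      \<open>r (i - 1)\<close>, shifted by one.\<close>
    moreover have "(w (Suc i), r i) \<in> E" if "Suc i < n"
      using that by (force simp: assms(5))
    moreover have "(w i, w (Suc i)) \<in> E" if "1 \<le> i" "Suc i < n"
      using that by (auto simp: assms(5))
    ultimately show ?thesis using that(2,3) unfolding assms(6) by blast
  qed
  show "agile G ?R"
    unfolding agile_def
  proof (intro conjI allI impI)
    show "?R \<subseteq> pverts G" by (simp add: assms(4))
    fix X1 X2 assume X: "X1 \<union> X2 = ?R \<and> X1 \<inter> X2 = {}"
    have verts: "?R \<union> w ` {1..<n} \<subseteq> pverts G" by (simp add: assms(4))
    note cover = path_cover_of_class[OF assms(1-3) wf verts]
    obtain T1 where T1: "subgraph (with_proj T1) (with_proj G)"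
      "ugraph_tree T1 \<or> X1 = {} \<and> T1 = empty_ugraph" "X1 \<subseteq> pverts T1"
      "pverts T1 \<subseteq> X1 \<union> {w i | i. 1 \<le> i \<and> i < n \<and> r i \<notin> X1}"
      using cover[of X1] arcs X by blast
    obtain T2 where T2: "subgraph (with_proj T2) (with_proj G)"
      "ugraph_tree T2 \<or> X2 = {} \<and> T2 = empty_ugraph" "X2 \<subseteq> pverts T2"
      "pverts T2 \<subseteq> X2 \<union> {w i | i. 1 \<le> i \<and> i < n \<and> r i \<notin> X2}"
      using cover[of X2] arcs X by blast
    have "pverts T1 \<inter> pverts T2 = {}"
    proof (rule ccontr)
      assume "pverts T1 \<inter> pverts T2 \<noteq> {}"
      then obtain x where x: "x \<in> pverts T1" "x \<in> pverts T2" by blast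
      have w_notin: "w i \<notin> X1 \<union> X2" if "1 \<le> i" "i < n" for i
        using X w_notin_R that by simp
      have w_inj: "i = j" if "w i = w j" "1 \<le> i" "i < n" "1 \<le> j" "j < n" for i j
        using that assms(2) by (auto dest: inj_onD)
      have r_in: "r i \<in> X1 \<union> X2" if "i < n" for i using X that by auto
      \<comment> \<open>A common vertex in \<open>X1 \<union> X2\<close> would lie in both classes,
        since no \<open>w\<close> is among the \<open>r\<close>. A common \<open>w i\<close> would
        put \<open>r i\<close> outside both classes.\<close>
      consider "x \<in> X1 \<union> X2" | i where "x = w i" "1 \<le> i" "i < n" "r i \<notin> X1"
        using x(1) T1(4) by blast
      then show False
      proof cases
        case 1
        then show False using x T1(4) T2(4) X w_notin by blast
      next
        case 2
        then obtain j where "x = w j" "1 \<le> j" "j < n" "r j \<notin> X2"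
          using x(2) T2(4) w_notin by blast
        then show False using 2 w_inj[of i j] r_in[of i] by auto
      qed
    qed
    then show "independent_pair G X1 X2"
      unfolding independent_pair_def using T1 T2 by blast
  qed
  define lev where "lev v = (if v \<in> ?R then int (the_inv_into {0..n} r v)
    else int (the_inv_into {1..<n} w v))" for v
  have lev_r: "lev (r i) = int i" if "i \<le> n" for i
    using that the_inv_into_f_f[OF assms(1), of i] by (auto simp: lev_def)
  have lev_w: "lev (w i) = int i" if "1 \<le> i" "i < n" for i
    using that the_inv_into_f_f[OF assms(2), of i] w_notin_R[of i] by (simp add: lev_def)
  interpret thin_levels G lev
  proof
    show "finite (pverts G)" by (simp add: assms(4))
    have "\<bar>lev u - lev v\<bar> \<le> 1" if "(u, v) \<in> E" for u v
      using that unfolding assms(5) by (auto simp: lev_r lev_w)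
    then show "\<bar>lev u - lev v\<bar> \<le> 1" if "(u, v) \<in> parcs G" for u v
      using that assms(6) by (fastforce simp: abs_minus_commute[of "lev u"])
    show "card {v \<in> pverts G. lev v = k} \<le> 2" for k
    proof -
      \<comment> \<open>Only an inclusion: at the end levels \<open>w (nat k)\<close> need not have
        level \<open>k\<close>, and for negative \<open>k\<close> the left side is empty.\<close>
      have "{v \<in> pverts G. lev v = k} \<subseteq> {r (nat k), w (nat k)}"
        by (auto simp: assms(4) lev_r lev_w)
      then have "card {v \<in> pverts G. lev v = k} \<le> card {r (nat k), w (nat k)}"
        by (intro card_mono) auto
      also have "\<dots> \<le> 2" by (simp add: card_insert_if)
      finally show ?thesis .
    qed
  qed
  show "\<not> (\<exists>K :: nat pair_pre_digraph. K\<^bsub>2,5\<^esub> (with_proj K) \<and> is_minor K G)"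
    using no_K_2_5_minor by blast
qed

end
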